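(* Let $n>1$ be an integer. The vertex independence number (maximum cardinality of an independent set of vertices) of the zero-divisor graph $\Gamma(\mathbb{Z}_{2^n}[i])$ is $$1+\sum_{j=n+1}^{2n-1}|V_{d_j}|.$$
   Context: $\mathbb{Z}_{2^n}[i]=\{a+ib: a,b\in\mathbb{Z}_{2^n}\}\cong \mathbb{Z}[i]/\langle 2^n\rangle$ is the ring of Gaussian integers modulo $2^n$. For a commutative ring $R$, the zero-divisor graph $\Gamma(R)$ is the simple graph whose vertex set is the set $\mathcal{Z}(R)$ of nonzero zero-divisors of $R$, two distinct vertices $x,y$ being adjacent if and only if $xy=0$. For $1\le j\le 2n-1$ put $d_j=(1+i)^{2n-j}\in\mathbb{Z}_{2^n}[i]$ (these are the proper divisors of $2^n$ up to associates), and let $V_{d_j}=\{u d_j: u \text{ a unit of } \mathbb{Z}_{2^n}[i]\}$ be the associate class of $d_j$. *)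

theory Defs
  imports "HOL-Number_Theory.Residues" "Graph_Theory.Pair_Digraph"
begin

text \<open>The ring \<open>R[i] = {a + ib : a, b \<in> R}\<close> with \<open>i\<^sup>2 = -1\<close>; the pair \<open>(a, b)\<close> stands for \<open>a + ib\<close>.\<close>

definition gauss_ring :: "('a, 'm) ring_scheme \<Rightarrow> ('a \<times> 'a) ring" where
  "gauss_ring R = \<lparr>
     carrier = carrier R \<times> carrier R,
     monoid.mult = (\<lambda>(a, b) (c, d).
       ((a \<otimes>\<^bsub>R\<^esub> c) \<ominus>\<^bsub>R\<^esub> (b \<otimes>\<^bsub>R\<^esub> d), (a \<otimes>\<^bsub>R\<^esub> d) \<oplus>\<^bsub>R\<^esub> (b \<otimes>\<^bsub>R\<^esub> c))),
     one = (\<one>\<^bsub>R\<^esub>, \<zero>\<^bsub>R\<^esub>),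
     zero = (\<zero>\<^bsub>R\<^esub>, \<zero>\<^bsub>R\<^esub>),
     add = (\<lambda>(a, b) (c, d). (a \<oplus>\<^bsub>R\<^esub> c, b \<oplus>\<^bsub>R\<^esub> d))\<rparr>"

definition gauss_i :: "('a, 'm) ring_scheme \<Rightarrow> 'a \<times> 'a" where
  "gauss_i R = (\<zero>\<^bsub>R\<^esub>, \<one>\<^bsub>R\<^esub>)"

lemma (in cring) cring_gauss_ring: "cring (gauss_ring R)"
proof (rule cringI)
  show "abelian_group (gauss_ring R)"
  proof (rule abelian_groupI)
    fix x assume "x \<in> carrier (gauss_ring R)"
    then obtain a b where x: "x = (a, b)" "a \<in> carrier R" "b \<in> carrier R"
      by (auto simp: gauss_ring_def)
    then show "\<exists>y\<in>carrier (gauss_ring R). y \<oplus>\<^bsub>gauss_ring R\<^esub> x = \<zero>\<^bsub>gauss_ring R\<^esub>"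
      by (intro bexI[of _ "(\<ominus> a, \<ominus> b)"]) (auto simp: gauss_ring_def l_neg)
  qed (auto simp: gauss_ring_def a_ac)
  show "Group.comm_monoid (gauss_ring R)"
  proof (rule comm_monoidI)
    fix x y z
    assume "x \<in> carrier (gauss_ring R)" "y \<in> carrier (gauss_ring R)" "z \<in> carrier (gauss_ring R)"
    then obtain a b c d e f where "x = (a, b)" "y = (c, d)" "z = (e, f)"
      and car: "a \<in> carrier R" "b \<in> carrier R" "c \<in> carrier R" "d \<in> carrier R"
        "e \<in> carrier R" "f \<in> carrier R"
      by (auto simp: gauss_ring_def)
    moreover have "(a \<otimes> c \<ominus> b \<otimes> d) \<otimes> e \<ominus> (a \<otimes> d \<oplus> b \<otimes> c) \<otimes> f =
        a \<otimes> (c \<otimes> e \<ominus> d \<otimes> f) \<ominus> b \<otimes> (c \<otimes> f \<oplus> d \<otimes> e)"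
      using car by algebra
    moreover have "(a \<otimes> c \<ominus> b \<otimes> d) \<otimes> f \<oplus> (a \<otimes> d \<oplus> b \<otimes> c) \<otimes> e =
        a \<otimes> (c \<otimes> f \<oplus> d \<otimes> e) \<oplus> b \<otimes> (c \<otimes> e \<ominus> d \<otimes> f)"
      using car by algebra
    ultimately show "x \<otimes>\<^bsub>gauss_ring R\<^esub> y \<otimes>\<^bsub>gauss_ring R\<^esub> z = x \<otimes>\<^bsub>gauss_ring R\<^esub> (y \<otimes>\<^bsub>gauss_ring R\<^esub> z)"
      by (simp add: gauss_ring_def)
  next
    fix x y
    assume "x \<in> carrier (gauss_ring R)" "y \<in> carrier (gauss_ring R)"
    then show "x \<otimes>\<^bsub>gauss_ring R\<^esub> y = y \<otimes>\<^bsub>gauss_ring R\<^esub> x"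
      by (auto simp: gauss_ring_def m_comm a_comm)
  qed (auto simp: gauss_ring_def minus_eq)
next
  fix x y z
  assume "x \<in> carrier (gauss_ring R)" "y \<in> carrier (gauss_ring R)" "z \<in> carrier (gauss_ring R)"
  then obtain a b c d e f where "x = (a, b)" "y = (c, d)" "z = (e, f)"
    and car: "a \<in> carrier R" "b \<in> carrier R" "c \<in> carrier R" "d \<in> carrier R"
      "e \<in> carrier R" "f \<in> carrier R"
    by (auto simp: gauss_ring_def)
  moreover have "(a \<oplus> c) \<otimes> e \<ominus> (b \<oplus> d) \<otimes> f = (a \<otimes> e \<ominus> b \<otimes> f) \<oplus> (c \<otimes> e \<ominus> d \<otimes> f)"
    using car by algebra
  moreover have "(a \<oplus> c) \<otimes> f \<oplus> (b \<oplus> d) \<otimes> e = (a \<otimes> f \<oplus> b \<otimes> e) \<oplus> (c \<otimes> f \<oplus> d \<otimes> e)"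
    using car by algebra
  ultimately show "(x \<oplus>\<^bsub>gauss_ring R\<^esub> y) \<otimes>\<^bsub>gauss_ring R\<^esub> z =
      x \<otimes>\<^bsub>gauss_ring R\<^esub> z \<oplus>\<^bsub>gauss_ring R\<^esub> y \<otimes>\<^bsub>gauss_ring R\<^esub> z"
    by (simp add: gauss_ring_def)
qed

lemma (in cring) gauss_i_square:
  "gauss_i R \<otimes>\<^bsub>gauss_ring R\<^esub> gauss_i R = \<ominus>\<^bsub>gauss_ring R\<^esub> \<one>\<^bsub>gauss_ring R\<^esub>"
proof -
  interpret G: cring "gauss_ring R" by (rule cring_gauss_ring)
  show ?thesis
    by (rule G.minus_equality[symmetric])
      (auto simp: gauss_ring_def gauss_i_def minus_eq l_neg)
qed

abbreviation zmod2_gauss :: "nat \<Rightarrow> (int \<times> int) ring" where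
  "zmod2_gauss n \<equiv> gauss_ring (residue_ring (2 ^ n))"

definition gauss_d :: "nat \<Rightarrow> nat \<Rightarrow> int \<times> int" where
  "gauss_d n j =
     (\<one>\<^bsub>zmod2_gauss n\<^esub> \<oplus>\<^bsub>zmod2_gauss n\<^esub> gauss_i (residue_ring (2 ^ n)))
       [^]\<^bsub>zmod2_gauss n\<^esub> (2 * n - j)"

definition associate_class :: "('a, 'm) ring_scheme \<Rightarrow> 'a \<Rightarrow> 'a set" where
  "associate_class R d = {u \<otimes>\<^bsub>R\<^esub> d | u. u \<in> Units R}"

definition nonzero_zero_divisors :: "('a, 'm) ring_scheme \<Rightarrow> 'a set" where
  "nonzero_zero_divisors R =
     {x \<in> carrier R. x \<noteq> \<zero>\<^bsub>R\<^esub> \<and> (\<exists>y\<in>carrier R. y \<noteq> \<zero>\<^bsub>R\<^esub> \<and> x \<otimes>\<^bsub>R\<^esub> y = \<zero>\<^bsub>R\<^esub>)}"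

text \<open>A simple graph is a \<open>pair_graph\<close>: an edge is represented by its two opposite arcs.\<close>

definition zero_divisor_graph :: "('a, 'm) ring_scheme \<Rightarrow> 'a pair_pre_digraph" where
  "zero_divisor_graph R = \<lparr>
     pverts = nonzero_zero_divisors R,
     parcs = {(x, y). x \<in> nonzero_zero_divisors R \<and> y \<in> nonzero_zero_divisors R \<and>
                      x \<noteq> y \<and> x \<otimes>\<^bsub>R\<^esub> y = \<zero>\<^bsub>R\<^esub>}\<rparr>"

definition independent_set :: "'a pair_pre_digraph \<Rightarrow> 'a set \<Rightarrow> bool" where
  "independent_set G S \<longleftrightarrow> S \<subseteq> pverts G \<and> (\<forall>x\<in>S. \<forall>y\<in>S. (x, y) \<notin> parcs G)"

text \<open>Meaningful for finite graphs only.\<close>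

definition independence_number :: "'a pair_pre_digraph \<Rightarrow> nat" where
  "independence_number G = Max {card S | S. independent_set G S}"

lemma (in cring) pair_graph_zero_divisor_graph:
  assumes "finite (carrier R)"
  shows "pair_graph (zero_divisor_graph R)"
proof -
  have fin: "finite (nonzero_zero_divisors R)"
    using assms by (simp add: nonzero_zero_divisors_def)
  have "parcs (zero_divisor_graph R) \<subseteq> nonzero_zero_divisors R \<times> nonzero_zero_divisors R"
    by (auto simp: zero_divisor_graph_def)
  then have "finite (parcs (zero_divisor_graph R))"
    using fin by (meson finite_SigmaI finite_subset)
  moreover have "(y, x) \<in> parcs (zero_divisor_graph R)"
    if "(x, y) \<in> parcs (zero_divisor_graph R)" for x y
    using that by (auto simp: zero_divisor_graph_def nonzero_zero_divisors_def m_comm[of y x])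
  then have "symmetric (with_proj (zero_divisor_graph R))"
    by (auto simp: symmetric_def arcs_ends_def arc_to_ends_def intro!: symI)
  ultimately show ?thesis
    using fin by unfold_locales (auto simp: zero_divisor_graph_def)
qed

lemma zmod2_gauss:
  assumes "n \<ge> 1"
  shows "cring (zmod2_gauss n)" "finite (carrier (zmod2_gauss n))"
    and "pair_graph (zero_divisor_graph (zmod2_gauss n))"
proof -
  have "(2::int) ^ n > 1"
    using assms by simp
  then interpret residues "2 ^ n" "residue_ring (2 ^ n)"
    by unfold_locales auto
  show cr: "cring (zmod2_gauss n)"
    by (rule cring_gauss_ring)
  show fin: "finite (carrier (zmod2_gauss n))"
    by (simp add: gauss_ring_def)
  show "pair_graph (zero_divisor_graph (zmod2_gauss n))"
    by (rule cring.pair_graph_zero_divisor_graph[OF cr fin])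
qed

end

theory Submission
  imports Defs
begin

text \<open>
  Put \<open>p = 1 + i\<close>. Since \<open>p\<^sup>2 = 2i\<close>, the ring is a finite chain ring with uniformizer \<open>p\<close> of
  nilpotency index \<open>2n\<close>: each nonzero element is \<open>u p\<^sup>k\<close> with \<open>u\<close> a unit and a unique \<open>k < 2n\<close>, and
  \<open>u p\<^sup>k\<close> and \<open>v p\<^sup>l\<close> annihilate each other iff \<open>k + l \<ge> 2n\<close>. Hence the vertices with \<open>k \<ge> n\<close> form a
  clique, of which an independent set contains at most one member, while those with
  \<open>1 \<le> k < n\<close> together with \<open>p\<^sup>n\<close> are independent.
\<close>

section \<open>Chain rings with a nilpotent uniformizer: levels and annihilation\<close>

locale nilpotent_uniformizer = cring R for R (structure) +
  fixes p :: 'a and N :: nat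
  assumes p_closed [simp]: "p \<in> carrier R"
    and N_pos: "0 < N"
    and p_pow_N: "p [^] N = \<zero>"
    and p_pow_pred_N: "p [^] (N - 1) \<noteq> \<zero>"
    and nonunit_divisible: "x \<in> carrier R \<Longrightarrow> x \<notin> Units R \<Longrightarrow> \<exists>y\<in>carrier R. x = p \<otimes> y"
begin

abbreviation level :: "nat \<Rightarrow> 'a set" where
  "level k \<equiv> associate_class R (p [^] k)"

text \<open>Each power with exponent below \<open>N\<close> divides \<open>p [^] (N - 1)\<close>,
  which is nonzero.\<close>

lemma p_pow_eq_zero_iff: "p [^] k = \<zero> \<longleftrightarrow> N \<le> k"
proof
  show "N \<le> k" if "p [^] k = \<zero>"
  proof (rule ccontr)
    assume "\<not> N \<le> k"
    then have "p [^] (N - 1) = p [^] k \<otimes> p [^] (N - 1 - k)"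
      by (simp add: nat_pow_mult)
    with that p_pow_pred_N show False by simp
  qed
next
  assume "N \<le> k"
  then have "p [^] k = p [^] N \<otimes> p [^] (k - N)"
    by (simp add: nat_pow_mult)
  then show "p [^] k = \<zero>" by (simp add: p_pow_N)
qed

lemma level_subset_carrier: "level k \<subseteq> carrier R"
  by (auto simp: associate_class_def)

lemma p_pow_in_level: "p [^] k \<in> level k"
  by (force simp: associate_class_def)

lemma unit_mult_eq_zero_iff:
  assumes "u \<in> Units R" "x \<in> carrier R"
  shows "u \<otimes> x = \<zero> \<longleftrightarrow> x = \<zero>"
proof
  assume "u \<otimes> x = \<zero>"
  then have "inv u \<otimes> (u \<otimes> x) = \<zero>"
    using assms by simp
  moreover have "inv u \<otimes> (u \<otimes> x) = inv u \<otimes> u \<otimes> x"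
    using assms by (simp only: m_assoc Units_closed Units_inv_closed)
  ultimately show "x = \<zero>"
    using assms by simp
qed (use assms in \<open>simp add: Units_closed\<close>)

text \<open>Unit factors cannot turn a nonzero element into zero, so only the sum of the exponents
  matters.\<close>

lemma level_mult_eq_zero_iff:
  assumes "x \<in> level k" "y \<in> level l"
  shows "x \<otimes> y = \<zero> \<longleftrightarrow> N \<le> k + l"
proof -
  obtain u v where uv: "u \<in> Units R" "v \<in> Units R" "x = u \<otimes> p [^] k" "y = v \<otimes> p [^] l"
    using assms by (auto simp: associate_class_def)
  then have "x \<otimes> y = (u \<otimes> v) \<otimes> (p [^] k \<otimes> p [^] l)"
    by (simp add: m_ac Units_closed)
  also have "\<dots> = (u \<otimes> v) \<otimes> p [^] (k + l)"
    by (simp add: nat_pow_mult)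
  finally show ?thesis
    using uv by (simp add: unit_mult_eq_zero_iff p_pow_eq_zero_iff)
qed

lemma level_eq_zero_iff:
  assumes "x \<in> level k"
  shows "x = \<zero> \<longleftrightarrow> N \<le> k"
  \<comment> \<open>Since \<open>p [^] 0 = \<one>\<close>, this is the product criterion for
    \<open>x \<otimes> \<one>\<close>.\<close>
  using level_mult_eq_zero_iff[OF assms p_pow_in_level[of 0]] subsetD[OF level_subset_carrier assms]
  by simp

text \<open>The element \<open>p [^] (N - 1 - k)\<close> separates the two levels: the exponents sum
  to \<open>N - 1\<close> on \<open>level k\<close>, giving a nonzero product, and to at least
  \<open>N\<close> on \<open>level l\<close>, giving zero.\<close>

lemma level_disjoint:
  assumes "k < l" "k < N"
  shows "level k \<inter> level l = {}"
proof -
  have False if "x \<in> level k" "x \<in> level l" for x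
    using level_mult_eq_zero_iff[OF that(1) p_pow_in_level[of "N - 1 - k"]]
      level_mult_eq_zero_iff[OF that(2) p_pow_in_level[of "N - 1 - k"]] assms
    by auto
  then show ?thesis by blast
qed

text \<open>Factors \<open>p\<close> are split off until the cofactor is a unit. This stops before
  \<open>N\<close> steps, since a multiple of \<open>p [^] N\<close> is zero.\<close>

lemma nonzero_in_level:
  assumes "x \<in> carrier R" "x \<noteq> \<zero>"
  obtains k where "k < N" "x \<in> level k"
proof -
  have "(\<exists>l<k. x \<in> level l) \<or> (\<exists>y\<in>carrier R. x = p [^] k \<otimes> y)" for k
  proof (induction k)
    case 0
    then show ?case using assms by auto
  next
    case (Suc k)
    show ?case
    proof (cases "\<exists>l<k. x \<in> level l")
      case True
      then show ?thesis using less_SucI by blast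
    next
      case False
      with Suc obtain y where y: "y \<in> carrier R" "x = p [^] k \<otimes> y" by blast
      show ?thesis
      proof (cases "y \<in> Units R")
        case True
        then have "x \<in> level k"
          using y by (auto simp: associate_class_def m_comm)
        then show ?thesis by blast
      next
        case False
        with y nonunit_divisible obtain z where "z \<in> carrier R" "y = p \<otimes> z" by blast
        then show ?thesis using y by (auto simp: m_assoc)
      qed
    qed
  qed
  from this[of N] show ?thesis
    using assms that by (auto simp: p_pow_N)
qed

text \<open>Level 0 consists of units and has no nonzero annihilator. For \<open>1 \<le> k\<close>
  the exponent \<open>N - k\<close> stays below \<open>N\<close>, so \<open>p [^] (N - k)\<close> is
  a nonzero annihilator of \<open>level k\<close>.\<close>

lemma nonzero_zero_divisors_eq_levels:
  "nonzero_zero_divisors R = (\<Union>k\<in>{1..<N}. level k)"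
proof (intro equalityI subsetI)
  fix x assume "x \<in> nonzero_zero_divisors R"
  then obtain y where x: "x \<in> carrier R" "x \<noteq> \<zero>" and y: "y \<in> carrier R" "y \<noteq> \<zero>" "x \<otimes> y = \<zero>"
    by (auto simp: nonzero_zero_divisors_def)
  obtain k where k: "k < N" "x \<in> level k" using x by (rule nonzero_in_level)
  obtain l where l: "l < N" "y \<in> level l" using y(1,2) by (rule nonzero_in_level)
  have "k \<in> {1..<N}"
    using level_mult_eq_zero_iff[OF k(2) l(2)] y(3) k l by auto
  then show "x \<in> (\<Union>k\<in>{1..<N}. level k)" using k by blast
next
  fix x assume "x \<in> (\<Union>k\<in>{1..<N}. level k)"
  then obtain k where k: "1 \<le> k" "k < N" "x \<in> level k" by auto
  have "x \<otimes> p [^] (N - k) = \<zero>"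
    using k by (simp add: level_mult_eq_zero_iff[OF k(3) p_pow_in_level])
  moreover have "p [^] (N - k) \<noteq> \<zero>" using k by (simp add: p_pow_eq_zero_iff)
  moreover have "x \<noteq> \<zero>" using k by (simp add: level_eq_zero_iff)
  ultimately show "x \<in> nonzero_zero_divisors R"
    using k level_subset_carrier by (auto simp: nonzero_zero_divisors_def)
qed

lemma finite_level:
  assumes "finite (carrier R)"
  shows "finite (level k)"
  using assms level_subset_carrier finite_subset by blast

lemma card_levels:
  assumes "finite (carrier R)" "n \<le> N"
  shows "card (\<Union>k\<in>{1..<n}. level k) = (\<Sum>k = 1..<n. card (level k))"
proof (rule card_UN_disjoint)
  show "\<forall>k\<in>{1..<n}. \<forall>l\<in>{1..<n}. k \<noteq> l \<longrightarrow> level k \<inter> level l = {}"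
  proof (intro ballI impI)
    fix k l assume "k \<in> {1..<n}" "l \<in> {1..<n}" "k \<noteq> l"
    then show "level k \<inter> level l = {}"
      using assms(2) level_disjoint[of k l] level_disjoint[of l k]
      by (cases "k < l") (auto simp: Int_commute)
  qed
qed (use assms finite_level in auto)

section \<open>The independence number of a chain ring of even nilpotency index\<close>

theorem independence_number_zero_divisor_graph:
  assumes fin: "finite (carrier R)" and N: "N = 2 * n"
  shows "independence_number (zero_divisor_graph R) = 1 + (\<Sum>k = 1..<n. card (level k))"
proof -
  let ?L = "\<Union>k\<in>{1..<n}. level k"
  have n: "0 < n" "n < N" using N N_pos by auto
  have card_L: "card ?L = (\<Sum>k = 1..<n. card (level k))"
    using card_levels fin n by simp
  have fin_L: "finite ?L" using finite_level[OF fin] by simp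
  have fin_V: "finite (nonzero_zero_divisors R)"
    using fin by (simp add: nonzero_zero_divisors_def)
  \<comment> \<open>Upper bound: outside \<open>?L\<close>, all of \<open>S\<close> lies in levels
    at or above \<open>n\<close>, where any two elements annihilate each other, so at most one
    element is left.\<close>
  have bound: "card S \<le> 1 + card ?L" if S: "independent_set (zero_divisor_graph R) S" for S
  proof -
    have S_ind: "x \<otimes> y \<noteq> \<zero>" if "x \<in> S" "y \<in> S" "x \<noteq> y" for x y
      using S that by (auto simp: independent_set_def zero_divisor_graph_def)
    have S_sub: "S \<subseteq> nonzero_zero_divisors R"
      using S by (auto simp: independent_set_def zero_divisor_graph_def)
    have high: "\<exists>k\<ge>n. x \<in> level k" if "x \<in> S - ?L" for x
    proof -
      obtain k where "k \<in> {1..<N}" "x \<in> level k"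
        using S_sub \<open>x \<in> S - ?L\<close> unfolding nonzero_zero_divisors_eq_levels by blast
      moreover have "n \<le> k"
        using calculation \<open>x \<in> S - ?L\<close> by (metis DiffD2 UN_I atLeastLessThan_iff not_le)
      ultimately show ?thesis by blast
    qed
    have "x = y" if xy: "x \<in> S - ?L" "y \<in> S - ?L" for x y
    proof (rule ccontr)
      assume "x \<noteq> y"
      obtain k l where "n \<le> k" "n \<le> l" "x \<in> level k" "y \<in> level l"
        using high[OF xy(1)] high[OF xy(2)] by blast
      then have "x \<otimes> y = \<zero>" by (simp add: level_mult_eq_zero_iff N)
      then show False using S_ind xy \<open>x \<noteq> y\<close> by blast
    qed
    then have "card (S - ?L) \<le> 1"
      by (metis One_nat_def card_le_Suc0_iff_eq finite_Diff finite_subset[OF S_sub fin_V])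
    moreover have "card S \<le> card (?L \<union> (S - ?L))"
      using fin_L finite_subset[OF S_sub fin_V] by (intro card_mono) auto
    ultimately show ?thesis
      using card_Un_le[of ?L "S - ?L"] by linarith
  qed
  have not_in: "p [^] n \<notin> ?L"
    using level_disjoint[of _ n] p_pow_in_level[of n] n by fastforce
  have ind: "independent_set (zero_divisor_graph R) (insert (p [^] n) ?L)"
  proof -
    have V: "insert (p [^] n) ?L \<subseteq> nonzero_zero_divisors R"
      unfolding nonzero_zero_divisors_eq_levels using n p_pow_in_level[of n] by fastforce
    have "x \<otimes> y \<noteq> \<zero>"
      if xy: "x \<in> insert (p [^] n) ?L" "y \<in> insert (p [^] n) ?L" "x \<noteq> y" for x y
    proof -
      \<comment> \<open>The second conjunct records that level \<open>n\<close> contributes only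
        \<open>p [^] n\<close>. Distinct \<open>x\<close> and \<open>y\<close> therefore cannot both
        have exponent \<open>n\<close>, and their exponents sum to less than
        \<open>2 * n\<close>.\<close>
      have lev: "\<exists>k\<le>n. z \<in> level k \<and> (k = n \<longrightarrow> z = p [^] n)" if "z \<in> insert (p [^] n) ?L" for z
        using that p_pow_in_level[of n] less_imp_le[of _ n] by fastforce
      obtain k where k: "k \<le> n" "x \<in> level k" "k = n \<longrightarrow> x = p [^] n"
        using lev[OF xy(1)] by blast
      obtain l where l: "l \<le> n" "y \<in> level l" "l = n \<longrightarrow> y = p [^] n"
        using lev[OF xy(2)] by blast
      have "k < n \<or> l < n" using k l xy(3) by auto
      then show ?thesis using k l by (auto simp: level_mult_eq_zero_iff N)
    qed
    with V show ?thesis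
      unfolding independent_set_def zero_divisor_graph_def by auto
  qed
  have "independence_number (zero_divisor_graph R) = 1 + card ?L"
    unfolding independence_number_def
  proof (rule Max_eqI)
    have "{S. independent_set (zero_divisor_graph R) S} \<subseteq> Pow (nonzero_zero_divisors R)"
      by (auto simp: independent_set_def zero_divisor_graph_def)
    then have "finite {S. independent_set (zero_divisor_graph R) S}"
      using fin_V finite_subset by blast
    then show "finite {card S |S. independent_set (zero_divisor_graph R) S}"
      by simp
    show "1 + card ?L \<in> {card S |S. independent_set (zero_divisor_graph R) S}"
      using ind not_in fin_L by (auto intro!: exI[of _ "insert (p [^] n) ?L"])
  qed (use bound in auto)
  then show ?thesis by (simp only: card_L)
qed

end

section \<open>Gaussian integers modulo \<open>2 ^ n\<close> with uniformizer
  \<open>1 + i\<close>\<close>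

context
  fixes n :: nat and G :: "(int \<times> int) ring"
  assumes n: "1 < n"
  defines "G \<equiv> zmod2_gauss n"
begin

interpretation residues "2 ^ n" "residue_ring (2 ^ n)"
  using n by unfold_locales auto

interpretation G: cring G
  unfolding G_def by (rule cring_gauss_ring)

text \<open>Makes \<open>2\<close> a reduced residue, so that \<open>(2, 0)\<close> lies in the
  carrier.\<close>

lemma two_lt_modulus: "(2::int) < 2 ^ n"
  using power_strict_increasing[of 1 n "2::int"] n by simp

lemma carrier_zmod2_gauss: "carrier G = {0..<2 ^ n} \<times> {0..<2 ^ n}"
  by (auto simp: G_def gauss_ring_def res_carrier_eq)

lemma zero_zmod2_gauss: "\<zero>\<^bsub>G\<^esub> = (0, 0)"
  by (simp add: G_def gauss_ring_def res_zero_eq)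

lemma one_zmod2_gauss: "\<one>\<^bsub>G\<^esub> = (1, 0)"
  by (simp add: G_def gauss_ring_def res_zero_eq res_one_eq)

lemma mult_zmod2_gauss:
  "(a, b) \<otimes>\<^bsub>G\<^esub> (c, d) = ((a * c - b * d) mod 2 ^ n, (a * d + b * c) mod 2 ^ n)"
  by (simp add: G_def gauss_ring_def a_minus_def res_neg_eq res_mult_eq res_add_eq
      mod_add_eq mod_simps)

lemma one_plus_i_zmod2_gauss:
  "\<one>\<^bsub>G\<^esub> \<oplus>\<^bsub>G\<^esub> gauss_i (residue_ring (2 ^ n)) = (1, 1)"
  using n
  by (simp add: G_def gauss_ring_def gauss_i_def res_zero_eq res_one_eq res_add_eq)

lemma pow_two_zmod2_gauss: "(2, 0) [^]\<^bsub>G\<^esub> (k::nat) = (2 ^ k mod 2 ^ n, 0)"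
proof (induction k)
  case 0
  then show ?case using n by (simp add: one_zmod2_gauss)
next
  case (Suc k)
  then show ?case by (simp add: mult_zmod2_gauss mod_simps mult.commute)
qed

text \<open>The norm \<open>a ^ 2 + b ^ 2\<close> has the parity of \<open>a + b\<close>; being odd,
  it is invertible modulo \<open>2 ^ n\<close>.\<close>

lemma odd_unit_zmod2_gauss:
  assumes "(a, b) \<in> carrier G" "odd (a + b)"
  shows "(a, b) \<in> Units G"
proof -
  have "coprime (a ^ 2 + b ^ 2) (2 ^ n)"
    using assms(2) by (simp add: coprime_right_2_iff_odd)
  then obtain c where c: "[(a ^ 2 + b ^ 2) * c = 1] (mod 2 ^ n)"
    using cong_solve_coprime_int by blast
  \<comment> \<open>The conjugate \<open>a - ib\<close> times the inverse \<open>c\<close> of the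
    norm.\<close>
  define y where "y = (a * c mod 2 ^ n, (- b * c) mod 2 ^ n)"
  have y: "y \<in> carrier G" by (simp add: y_def carrier_zmod2_gauss)
  have "(a, b) \<otimes>\<^bsub>G\<^esub> y =
      ((a * (a * c) - b * (- b * c)) mod 2 ^ n, (a * (- b * c) + b * (a * c)) mod 2 ^ n)"
    unfolding y_def mult_zmod2_gauss
    by (intro arg_cong2[of _ _ _ _ Pair]) (rule mod_diff_cong mod_add_cong; simp only: mod_simps)+
  also have "a * (a * c) - b * (- b * c) = (a ^ 2 + b ^ 2) * c"
    by (simp add: algebra_simps power2_eq_square)
  also have "a * (- b * c) + b * (a * c) = 0"
    by (simp add: algebra_simps)
  finally have "(a, b) \<otimes>\<^bsub>G\<^esub> y = \<one>\<^bsub>G\<^esub>"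
    using c n by (simp add: cong_def one_zmod2_gauss)
  then show ?thesis
    using assms(1) y G.m_comm[OF assms(1) y] unfolding Units_def by auto
qed

lemma even_divisible_zmod2_gauss:
  assumes "(a, b) \<in> carrier G" "even (a + b)"
  shows "\<exists>y\<in>carrier G. (a, b) = (1, 1) \<otimes>\<^bsub>G\<^esub> y"
proof
  \<comment> \<open>Over the complex numbers,
    \<open>(a + ib) / (1 + i) = ((a + b) + i (b - a)) / 2\<close>; even \<open>a + b\<close> makes
    both halves integers.\<close>
  define c d where "c = (a + b) div 2" and "d = (b - a) div 2"
  have cd: "c - d = a" "c + d = b"
    using assms(2) unfolding c_def d_def by presburger+
  show "(c mod 2 ^ n, d mod 2 ^ n) \<in> carrier G"
    by (simp add: carrier_zmod2_gauss)
  show "(a, b) = (1, 1) \<otimes>\<^bsub>G\<^esub> (c mod 2 ^ n, d mod 2 ^ n)"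
    using assms(1) cd
    by (simp add: mult_zmod2_gauss mod_simps carrier_zmod2_gauss add.commute)
qed

lemma nilpotent_uniformizer_zmod2_gauss: "nilpotent_uniformizer G (1, 1) (2 * n)"
proof
  have n': "(1::int) < 2 ^ n" "(2::int) < 2 ^ n" using two_lt_modulus by auto
  \<comment> \<open>This is \<open>-i\<close>, the inverse of \<open>i\<close>.\<close>
  let ?m = "(0, 2 ^ n - 1)"
  have cl: "(1, 1) \<in> carrier G" "(2, 0) \<in> carrier G" "(0, 1) \<in> carrier G" "?m \<in> carrier G"
    using n' by (auto simp: carrier_zmod2_gauss)
  then show "(1, 1) \<in> carrier G" by simp
  show "0 < 2 * n" using n by simp
  have sq: "(1, 1) [^]\<^bsub>G\<^esub> (2::nat) = (2, 0) \<otimes>\<^bsub>G\<^esub> (0, 1)"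
    using cl n n' by (simp add: numeral_2_eq_2 one_zmod2_gauss mult_zmod2_gauss)
  \<comment> \<open>From \<open>(1 + i)^2 = 2i\<close>, the power is \<open>2^n i^n\<close>, whose
    first factor vanishes.\<close>
  have "(1, 1) [^]\<^bsub>G\<^esub> (2 * n) = ((2, 0) \<otimes>\<^bsub>G\<^esub> (0, 1)) [^]\<^bsub>G\<^esub> n"
    using cl by (simp add: sq flip: G.nat_pow_pow)
  also have "\<dots> = \<zero>\<^bsub>G\<^esub> \<otimes>\<^bsub>G\<^esub> (0, 1) [^]\<^bsub>G\<^esub> n"
    using cl by (simp add: G.nat_pow_distrib pow_two_zmod2_gauss zero_zmod2_gauss)
  also have "\<dots> = \<zero>\<^bsub>G\<^esub>" using cl by simp
  finally show "(1, 1) [^]\<^bsub>G\<^esub> (2 * n) = \<zero>\<^bsub>G\<^esub>" .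
  show "(1, 1) [^]\<^bsub>G\<^esub> (2 * n - 1) \<noteq> \<zero>\<^bsub>G\<^esub>"
  proof
    assume zero: "(1, 1) [^]\<^bsub>G\<^esub> (2 * n - 1) = \<zero>\<^bsub>G\<^esub>"
    \<comment> \<open>Multiplying by \<open>-i\<close> turns the square \<open>2i\<close> into
      \<open>2\<close>. Hence \<open>(1 + i)^(2n-1)\<close> times \<open>(-i)^(n-1)\<close> is
      \<open>2^(n-1) (1 + i)\<close>, whose coordinates are nonzero modulo
      \<open>2 ^ n\<close>.\<close>
    have sq': "(1, 1) [^]\<^bsub>G\<^esub> (2::nat) \<otimes>\<^bsub>G\<^esub> ?m = (2, 0)"
    proof -
      have "- (2 * (2 ^ n - 1)) mod (2::int) ^ n = (2 - 2 * 2 ^ n) mod 2 ^ n" by simp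
      also have "\<dots> = 2" using n' by (simp add: mod_diff_eq[symmetric, of 2])
      finally show ?thesis
        using n n' by (simp add: numeral_2_eq_2 one_zmod2_gauss mult_zmod2_gauss)
    qed
    have "2 * n - 1 = 1 + 2 * (n - 1)" using n by simp
    then have "(1, 1) [^]\<^bsub>G\<^esub> (2 * n - 1) = (1, 1) \<otimes>\<^bsub>G\<^esub> ((1, 1) [^]\<^bsub>G\<^esub> (2::nat)) [^]\<^bsub>G\<^esub> (n - 1)"
      using cl by (simp add: G.nat_pow_pow G.m_comm)
    then have "(1, 1) [^]\<^bsub>G\<^esub> (2 * n - 1) \<otimes>\<^bsub>G\<^esub> ?m [^]\<^bsub>G\<^esub> (n - 1) =
        (1, 1) \<otimes>\<^bsub>G\<^esub> ((1, 1) [^]\<^bsub>G\<^esub> (2::nat) \<otimes>\<^bsub>G\<^esub> ?m) [^]\<^bsub>G\<^esub> (n - 1)"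
      using cl by (simp add: G.nat_pow_distrib G.m_assoc)
    also have "\<dots> = (2 ^ (n - 1), 2 ^ (n - 1))"
      unfolding sq' using n by (simp add: pow_two_zmod2_gauss mult_zmod2_gauss)
    finally have "(2 ^ (n - 1), 2 ^ (n - 1)) = \<zero>\<^bsub>G\<^esub>"
      using cl unfolding zero by simp
    then show False by (simp add: zero_zmod2_gauss)
  qed
  show "\<exists>y\<in>carrier G. x = (1, 1) \<otimes>\<^bsub>G\<^esub> y" if "x \<in> carrier G" "x \<notin> Units G" for x
    using that odd_unit_zmod2_gauss even_divisible_zmod2_gauss by (cases x) blast
qed

end

theorem theorem3p1:
  fixes n :: nat
  assumes "n > 1"
  shows "independence_number (zero_divisor_graph (zmod2_gauss n)) =
    1 + (\<Sum>j = n + 1..2 * n - 1. card (associate_class (zmod2_gauss n) (gauss_d n j)))"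
proof -
  interpret nilpotent_uniformizer "zmod2_gauss n" "(1, 1)" "2 * n"
    using assms by (rule nilpotent_uniformizer_zmod2_gauss)
  have "(\<Sum>k = 1..<n. card (level k)) =
      (\<Sum>j = n + 1..2 * n - 1. card (associate_class (zmod2_gauss n) (gauss_d n j)))"
    \<comment> \<open>As \<open>gauss_d n j\<close> is \<open>1 + i\<close> to the power
      \<open>2 * n - j\<close>, the levels \<open>1..<n\<close> correspond to the indices
      \<open>j\<close> from \<open>n + 1\<close> to \<open>2 * n - 1\<close>.\<close>
    by (rule sum.reindex_bij_witness[of _ "\<lambda>j. 2 * n - j" "\<lambda>k. 2 * n - k"])
      (auto simp: gauss_d_def one_plus_i_zmod2_gauss[OF assms])
  moreover have "finite (carrier (zmod2_gauss n))"
    using assms by (intro zmod2_gauss(2)) simp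
  ultimately show ?thesis
    by (simp only: independence_number_zero_divisor_graph)
qed

end
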